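(* Let $k$ be a positive integer, and let $\alpha^*$ be the unique root in $[1/2,1]$ of the equation $$\alpha = (2-2\alpha)\left(1+ \sum^k_{i=0} \frac{1}{i!}\left(\ln \frac{1}{2-2\alpha}\right)^i\right).$$ Then $\tilde{c}_k \leq \alpha^*$.
   Context: A subset $A$ of an additive group is called sumfree if $x+y\neq z$ for all $x,y,z\in A$ (not necessarily distinct). For a positive integer $k$, subsets of $[0,1]^k$ are regarded as subsets of the additive group $\mathbb{R}^k$, $\mathrm{Vol}$ denotes Lebesgue measure on $\mathbb{R}^k$, and $$\tilde{c}_k := \sup \{\mathrm{Vol}(S) : S \subset [0,1]^k \text{ is Lebesgue measurable and sumfree}\}.$$ At $\alpha=1$ the right-hand side of the equation is interpreted as its limit $0$ as $\alpha\to 1^-$ (so $\alpha = 1$ is not a root). *)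

theory Defs
  imports "HOL-Analysis.Analysis"
begin

definition sumfree :: "'a::ab_group_add set \<Rightarrow> bool" where
  "sumfree A \<longleftrightarrow> (\<forall>x\<in>A. \<forall>y\<in>A. \<forall>z\<in>A. x + y \<noteq> z)"

definition unit_cube :: "(real ^ 'k::finite) set" where
  "unit_cube = {x. \<forall>i. x $ i \<in> {0..1}}"

(* The dimension is carried by the index type: k = CARD('k), which is positive
   because types are nonempty. The set of volumes contains 0 (take S empty) and is
   bounded by 1, so this Sup on the reals is a genuine supremum. *)
definition c_tilde :: "'k::finite itself \<Rightarrow> real" where
  "c_tilde _ = Sup {measure lebesgue S | S :: (real ^ 'k) set.
     S \<subseteq> unit_cube \<and> S \<in> sets lebesgue \<and> sumfree S}"

(* At a = 1 the vanishing prefactor makes this expression 0, which is also its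
   limit from the left. *)
definition alpha_rhs :: "nat \<Rightarrow> real \<Rightarrow> real" where
  "alpha_rhs k a =
     (2 - 2 * a) * (1 + (\<Sum>i=0..k. 1 / fact i * ln (1 / (2 - 2 * a)) ^ i))"

definition is_alpha_root :: "nat \<Rightarrow> real \<Rightarrow> bool" where
  "is_alpha_root k a \<longleftrightarrow> a \<in> {1/2..1} \<and> a = alpha_rhs k a"

definition alpha_star :: "nat \<Rightarrow> real" where
  "alpha_star k = (THE a. is_alpha_root k a)"

end

(* If S is sumfree and x lies in S, then the translate by x of the part of S in the box [0, 1 - x]
   is disjoint from the part of S in the box [x, 1]. Comparing volumes gives
   prod_i (1 - x_i) <= t with t = 2 - 2 Vol(S), so Vol(S) is at most the volume of the set of all
   points of the cube with this property, which is t * sum_(i<k) ln(1/t)^i / i! and hence below the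
   right-hand side of the equation. As a function of t that right-hand side strictly increases,
   with derivative 1 + ln(1/t)^k / k!, while a = 1 - t/2 strictly decreases. *)
theory Submission
  imports Defs
begin

section \<open>Volume of the region of the cube cut off by a product condition\<close>

text \<open>For 0 < t < 1 this is the volume of the points of [0,1]^n with prod_i (1 - x_i) \<le> t,
  equivalently the probability that a product of n independent uniform variables on [0,1] is at most
  t. For n = 0 the empty product 1 exceeds t, which matches the empty sum.\<close>

definition hyperbolic_vol :: "nat \<Rightarrow> real \<Rightarrow> real" where
  "hyperbolic_vol n t = t * (\<Sum>i<n. ln (1 / t) ^ i / fact i)"

lemma hyperbolic_vol_nonneg:
  assumes "0 < t" "t \<le> 1"
  shows "0 \<le> hyperbolic_vol n t"
  unfolding hyperbolic_vol_def using assms by (intro mult_nonneg_nonneg sum_nonneg) auto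

text \<open>This is the recursion in the dimension: one coordinate y is integrated out over the
  range where the rescaled threshold t / (1 - y) is at most 1. The remaining range [1 - t, 1]
  accounts for the missing summand t.\<close>

lemma nn_integral_hyperbolic_vol:
  assumes "0 < t" "t < 1"
  shows "(\<integral>\<^sup>+y. ennreal (hyperbolic_vol n (t / (1 - y))) * indicator {0..1 - t} y \<partial>lborel)
    = ennreal (hyperbolic_vol (Suc n) t - t)"
proof -
  \<comment> \<open>The antiderivative is found term by term: integrating ln((1 - y) / t)^i / (1 -
    y) raises the exponent by one. It vanishes at y = 1 - t because ln 1 = 0, and its value at 0
    supplies all terms of \<open>hyperbolic_vol (Suc n) t\<close> except the one for i = 0.\<close>
  define F where "F y = - t * (\<Sum>i<n. ln ((1 - y) / t) ^ Suc i / fact (Suc i))" for y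
  have "(\<integral>\<^sup>+y. ennreal (hyperbolic_vol n (t / (1 - y))) * indicator {0..1 - t} y \<partial>lborel)
    = ennreal (F (1 - t) - F 0)"
  proof (rule nn_integral_FTC_Icc)
    show "(\<lambda>y. hyperbolic_vol n (t / (1 - y))) \<in> borel_measurable borel"
      unfolding hyperbolic_vol_def by measurable
    show "0 \<le> 1 - t" using assms by simp
  next
    fix y assume y: "y \<in> {0..1 - t}"
    then have pos: "0 < 1 - y" and "t \<le> 1 - y" using assms by simp_all
    then show "0 \<le> hyperbolic_vol n (t / (1 - y))"
      using assms by (intro hyperbolic_vol_nonneg) auto
    have "((\<lambda>y. ln ((1 - y) / t) ^ Suc i / fact (Suc i)) has_real_derivative
        - (ln ((1 - y) / t) ^ i / fact i / (1 - y))) (at y)" for i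
    proof -
      have "((\<lambda>y. ln ((1 - y) / t)) has_real_derivative - (1 / (1 - y))) (at y)"
        by (rule derivative_eq_intros refl | (use pos assms in simp; fail))+
      from DERIV_cdivide[OF DERIV_power[OF this, of "Suc i"], of "fact (Suc i)"] show ?thesis
        by (rule DERIV_cong) (use pos in \<open>simp add: divide_simps del: of_nat_Suc\<close>)
    qed
    note D = this
    have "(F has_real_derivative - t * (\<Sum>i<n. - (ln ((1 - y) / t) ^ i / fact i / (1 - y)))) (at y)"
      unfolding F_def by (intro DERIV_cmult DERIV_sum D)
    moreover have "- t * (\<Sum>i<n. - (ln ((1 - y) / t) ^ i / fact i / (1 - y)))
        = hyperbolic_vol n (t / (1 - y))"
      by (simp add: hyperbolic_vol_def sum_negf flip: sum_divide_distrib divide_divide_eq_left)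
    ultimately show "(F has_real_derivative hyperbolic_vol n (t / (1 - y))) (at y)"
      by simp
  qed
  also have "F (1 - t) = 0" using assms by (simp add: F_def)
  also have "0 - F 0 = hyperbolic_vol (Suc n) t - t"
    by (simp add: F_def hyperbolic_vol_def sum.lessThan_Suc_shift algebra_simps del: sum.lessThan_Suc)
  finally show ?thesis .
qed

text \<open>Induction on the index set, slicing by Fubini at x_j = y. For y < 1 - t the slice is the
  same kind of region with threshold t / (1 - y) < 1; for y \<ge> 1 - t it is bounded by the whole
  cube, of volume 1.\<close>

lemma emeasure_PiM_hyperbolic_le:
  fixes I :: "'i set"
  assumes "finite I" "0 < t" "t < 1"
  shows "emeasure (Pi\<^sub>M I (\<lambda>_. lborel :: real measure))
      {x \<in> space (Pi\<^sub>M I (\<lambda>_. lborel)). (\<forall>i\<in>I. x i \<in> {0..1}) \<and> (\<Prod>i\<in>I. 1 - x i) \<le> t}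
    \<le> ennreal (hyperbolic_vol (card I) t)"
  using assms
proof (induction I arbitrary: t rule: finite_induct)
  case empty
  then have "{x \<in> space (Pi\<^sub>M {} (\<lambda>_::'i. lborel :: real measure)).
      (\<forall>i\<in>{}. x i \<in> {0..1}) \<and> (\<Prod>i\<in>{}. 1 - x i) \<le> t} = {}"
    by auto
  then show ?case by (simp only: emeasure_empty) simp
next
  case (insert j I)
  interpret product_sigma_finite "\<lambda>_::'i. lborel :: real measure" by standard
  define M where "M J = Pi\<^sub>M J (\<lambda>_::'i. lborel :: real measure)" for J
  define A where "A J s = {x \<in> space (M J). (\<forall>i\<in>J. x i \<in> {0..1}) \<and> (\<Prod>i\<in>J. 1 - x i) \<le> s}"
    for J and s :: real
  have A_sets [measurable]: "A J s \<in> sets (M J)" if "finite J" for J s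
    unfolding A_def M_def using that by measurable
  have "emeasure (M (insert j I)) (A (insert j I) t)
      = (\<integral>\<^sup>+x. indicator (A (insert j I) t) x \<partial>M (insert j I))"
    using insert by (intro nn_integral_indicator[symmetric] A_sets) auto
  also have "\<dots> = (\<integral>\<^sup>+y. (\<integral>\<^sup>+x. indicator (A (insert j I) t) (x(j := y)) \<partial>M I) \<partial>lborel)"
    unfolding M_def
    by (rule product_nn_integral_insert_rev)
       (use insert A_sets[of "insert j I" t] in \<open>auto simp: M_def\<close>)
  \<comment> \<open>The two closed intervals overlap at y = 1 - t. This is harmless for an upper
    bound and adds nothing to the integral.\<close>
  also have "\<dots> \<le> (\<integral>\<^sup>+y. ennreal (hyperbolic_vol (card I) (t / (1 - y))) * indicator {0..1 - t} y
      + indicator {1 - t..1} y \<partial>lborel)"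
  proof (rule nn_integral_mono)
    fix y :: real
    have upd: "x(j := y) \<in> A (insert j I) t \<longleftrightarrow>
        y \<in> {0..1} \<and> (\<forall>i\<in>I. x i \<in> {0..1}) \<and> (1 - y) * (\<Prod>i\<in>I. 1 - x i) \<le> t"
      if "x \<in> space (M I)" for x
    proof -
      have "(\<Prod>i\<in>I. 1 - (x(j := y)) i) = (\<Prod>i\<in>I. 1 - x i)"
        using insert by (intro prod.cong) auto
      moreover have "x(j := y) \<in> space (M (insert j I))"
        using that by (auto simp: M_def space_PiM PiE_iff extensional_def)
      moreover have "(\<forall>i\<in>I. (x(j := y)) i \<in> {0..1}) \<longleftrightarrow> (\<forall>i\<in>I. x i \<in> {0..1})"
        using insert by (intro ball_cong) auto
      ultimately show ?thesis
        using insert by (simp add: A_def)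
    qed
    consider "y \<notin> {0..1}" | "y \<in> {0..<1 - t}" | "y \<in> {1 - t..1}" by force
    then show "(\<integral>\<^sup>+x. indicator (A (insert j I) t) (x(j := y)) \<partial>M I)
      \<le> ennreal (hyperbolic_vol (card I) (t / (1 - y))) * indicator {0..1 - t} y
        + indicator {1 - t..1} y"
    proof cases
      case 1
      then have "(\<integral>\<^sup>+x. indicator (A (insert j I) t) (x(j := y)) \<partial>M I) = (\<integral>\<^sup>+x. 0 \<partial>M I)"
        by (intro nn_integral_cong) (auto simp: upd indicator_def)
      then show ?thesis by simp
    next
      case 2
      then have "1 - y > 0" using insert by auto
      have "(\<integral>\<^sup>+x. indicator (A (insert j I) t) (x(j := y)) \<partial>M I)
          = (\<integral>\<^sup>+x. indicator (A I (t / (1 - y))) x \<partial>M I)"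
      proof (rule nn_integral_cong)
        fix x assume x: "x \<in> space (M I)"
        have "x(j := y) \<in> A (insert j I) t \<longleftrightarrow> x \<in> A I (t / (1 - y))"
          unfolding upd[OF x] using 2 \<open>1 - y > 0\<close> insert.prems x
          by (auto simp: A_def pos_le_divide_eq mult.commute)
        then show "indicator (A (insert j I) t) (x(j := y))
            = (indicator (A I (t / (1 - y))) x :: ennreal)"
          by (simp add: indicator_def)
      qed
      also have "\<dots> = emeasure (M I) (A I (t / (1 - y)))"
        using insert by (intro nn_integral_indicator A_sets) auto
      also have "\<dots> \<le> ennreal (hyperbolic_vol (card I) (t / (1 - y)))"
        unfolding A_def M_def using 2 insert.prems \<open>1 - y > 0\<close>
        by (intro insert.IH) (auto simp: field_simps)
      finally show ?thesis using 2 by simp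
    next
      case 3
      have "(\<integral>\<^sup>+x. indicator (A (insert j I) t) (x(j := y)) \<partial>M I)
          \<le> (\<integral>\<^sup>+x. indicator (Pi\<^sub>E I (\<lambda>_. {0..1})) x \<partial>M I)"
        by (intro nn_integral_mono)
          (auto simp: upd indicator_def M_def space_PiM PiE_iff)
      also have "\<dots> = emeasure (M I) (Pi\<^sub>E I (\<lambda>_. {0..1}))"
        unfolding M_def using insert by (intro nn_integral_indicator sets_PiM_I_finite) auto
      also have "\<dots> = 1"
        unfolding M_def by (subst emeasure_PiM) (use insert in auto)
      finally show ?thesis using 3 by (simp add: add_increasing)
    qed
  qed
  also have "\<dots> = (\<integral>\<^sup>+y. ennreal (hyperbolic_vol (card I) (t / (1 - y))) * indicator {0..1 - t} y \<partial>lborel)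
      + (\<integral>\<^sup>+y. indicator {1 - t..1} y \<partial>lborel)"
    by (intro nn_integral_add) (auto simp: hyperbolic_vol_def)
  also have "\<dots> = ennreal (hyperbolic_vol (Suc (card I)) t - t) + ennreal t"
    using insert.prems by (simp add: nn_integral_hyperbolic_vol)
  also have "\<dots> = ennreal (hyperbolic_vol (Suc (card I)) t)"
  proof -
    \<comment> \<open>Since \<open>ennreal\<close> sends negative reals to 0, the two values can be
      added as reals only once both are known to be nonnegative.\<close>
    have "0 \<le> hyperbolic_vol (Suc (card I)) t - t"
    proof -
      have "hyperbolic_vol (Suc (card I)) t - t = t * (\<Sum>i<card I. ln (1 / t) ^ Suc i / fact (Suc i))"
        by (simp add: hyperbolic_vol_def sum.lessThan_Suc_shift algebra_simps del: sum.lessThan_Suc)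
      also have "\<dots> \<ge> 0"
        using insert.prems by (intro mult_nonneg_nonneg sum_nonneg divide_nonneg_nonneg zero_le_power) auto
      finally show ?thesis .
    qed
    with insert.prems show ?thesis by (subst ennreal_plus[symmetric]) auto
  qed
  finally show ?case using insert by (simp add: M_def A_def)
qed

text \<open>Lebesgue measure on a Euclidean space is the image of the product measure under the
  coordinate map, so the bound carries over.\<close>

lemma emeasure_lborel_hyperbolic_le:
  assumes "0 < t" "t < 1"
  shows "emeasure lborel {x :: 'a::euclidean_space. (\<forall>b\<in>Basis. x \<bullet> b \<in> {0..1}) \<and> (\<Prod>b\<in>Basis. 1 - x \<bullet> b) \<le> t}
    \<le> ennreal (hyperbolic_vol DIM('a) t)" (is "emeasure lborel ?A \<le> _")
proof -
  let ?M = "Pi\<^sub>M (Basis :: 'a set) (\<lambda>_. lborel :: real measure)"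
  let ?h = "\<lambda>f. \<Sum>b\<in>Basis. f b *\<^sub>R (b::'a)"
  have "?A \<in> sets borel" by measurable
  then have "emeasure lborel ?A = emeasure ?M (?h -` ?A \<inter> space ?M)"
    by (subst lborel_eq, subst emeasure_distr) auto
  also have "?h -` ?A \<inter> space ?M = {x \<in> space ?M.
      (\<forall>b\<in>Basis. x b \<in> {0..1}) \<and> (\<Prod>b\<in>Basis. 1 - x b) \<le> t}"
    by auto
  also have "emeasure ?M \<dots> \<le> ennreal (hyperbolic_vol DIM('a) t)"
    using assms by (intro emeasure_PiM_hyperbolic_le) auto
  finally show ?thesis .
qed

section \<open>Volume constraint on sumfree sets\<close>

text \<open>Both boxes have volume p = prod_i (1 - x_i), and \<open>S\<close> misses at most 1 -
  Vol(S) of each. The translated part of \<open>S\<close> in \<open>A\<close> and the part in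
  \<open>B\<close> are disjoint inside \<open>B\<close>, so 2 (p - (1 - Vol(S))) \<le> p.\<close>

lemma sumfree_prod_le:
  fixes S :: "'a::euclidean_space set"
  assumes S: "S \<in> sets lebesgue" "S \<subseteq> cbox 0 One" "sumfree S" and x: "x \<in> S"
  shows "(\<Prod>b\<in>Basis. 1 - x \<bullet> b) \<le> 2 * (1 - measure lebesgue S)"
proof -
  let ?m = "measure lebesgue"
  define p where "p = (\<Prod>b\<in>Basis. 1 - x \<bullet> b)"
  define A B U where "A = cbox 0 (One - x)" and "B = cbox x One" and "U = cbox (0::'a) One"
  have xU: "0 \<le> x \<bullet> b" "x \<bullet> b \<le> 1" if "b \<in> Basis" for b
    using S x that by (auto simp: mem_box)
  have lm [simp, intro]: "A \<in> lmeasurable" "B \<in> lmeasurable" "U \<in> lmeasurable"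
    by (auto simp: A_def B_def U_def)
  have mA: "?m A = p" and mB: "?m B = p" and mU: "?m U = 1"
    using xU by (simp_all add: A_def B_def U_def p_def content_cbox_if box_eq_empty inner_diff_left
      not_less[symmetric] cong: prod.cong)
  have sub: "A \<subseteq> U" "B \<subseteq> U" using xU
    by (auto simp: A_def B_def U_def mem_box inner_diff_left) force+
  have SL: "S \<in> lmeasurable"
    using S by (intro fmeasurableI2[OF lm(3)]) (auto simp: U_def)
  have part: "?m (S \<inter> C) \<ge> p - (1 - ?m S)" if "C \<in> lmeasurable" "C \<subseteq> U" "?m C = p" for C
  proof -
    have "?m (S \<union> C) = ?m S + ?m C - ?m (S \<inter> C)"
      using that SL by (intro measure_Un3) auto
    moreover have "?m (S \<union> C) \<le> ?m U"
      using that SL S by (intro measure_mono_fmeasurable) (auto simp: U_def)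
    ultimately show ?thesis using that mU by simp
  qed
  \<comment> \<open>A common point would be z = x + y with x, y and z all in
    \<open>S\<close>.\<close>
  have disj: "(+) x ` (S \<inter> A) \<inter> (S \<inter> B) = {}"
    using S(3) x unfolding sumfree_def by blast
  have "?m (S \<inter> A) + ?m (S \<inter> B) = ?m ((+) x ` (S \<inter> A)) + ?m (S \<inter> B)"
    by (simp add: measure_translation)
  also have "\<dots> = ?m ((+) x ` (S \<inter> A) \<union> (S \<inter> B))"
    using disj SL by (subst measure_Un3) (auto intro: measurable_translation fmeasurable.Int)
  also have "\<dots> \<le> ?m B"
  proof (rule measure_mono_fmeasurable)
    show "(+) x ` (S \<inter> A) \<union> S \<inter> B \<subseteq> B"
      using xU by (auto simp: A_def B_def mem_box inner_diff_left inner_add_left algebra_simps)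
    show "(+) x ` (S \<inter> A) \<union> S \<inter> B \<in> sets lebesgue"
      using SL by (intro fmeasurableD fmeasurable.Un measurable_translation fmeasurable.Int) auto
  qed auto
  finally have "?m (S \<inter> A) + ?m (S \<inter> B) \<le> p" by (simp add: mB)
  with part[of A] part[of B] sub mA mB show ?thesis by (simp add: p_def)
qed

text \<open>Every point of \<open>S\<close> satisfies the product condition, so \<open>S\<close>
  lies in the region measured above. Taking \<open>t\<close> as any upper bound for 2 (1 - Vol(S))
  lets it be fixed independently of \<open>S\<close>, and covers the case Vol(S) = 1, where that
  quantity is 0.\<close>

lemma measure_sumfree_le:
  fixes S :: "'a::euclidean_space set"
  assumes S: "S \<in> sets lebesgue" "S \<subseteq> cbox 0 One" "sumfree S"
    and t: "0 < t" "t < 1" "2 * (1 - measure lebesgue S) \<le> t"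
  shows "measure lebesgue S \<le> hyperbolic_vol DIM('a) t"
proof -
  let ?A = "{x::'a. (\<forall>b\<in>Basis. x \<bullet> b \<in> {0..1}) \<and> (\<Prod>b\<in>Basis. 1 - x \<bullet> b) \<le> t}"
  have A: "?A \<in> sets borel" by measurable
  have "S \<subseteq> ?A"
    using S(2) sumfree_prod_le[OF S] t(3) by (fastforce simp: mem_box)
  then have "emeasure lebesgue S \<le> emeasure lebesgue ?A"
    using A by (intro emeasure_mono) auto
  also have "\<dots> = emeasure lborel ?A" using A by simp
  also have "\<dots> \<le> ennreal (hyperbolic_vol DIM('a) t)"
    by (rule emeasure_lborel_hyperbolic_le) fact+
  finally show ?thesis
    using hyperbolic_vol_nonneg[of t "DIM('a)"] t unfolding measure_def
    by (simp add: enn2real_leI)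
qed

section \<open>The equation and its unique root\<close>

text \<open>The right-hand side of the equation in the variable t = 2 - 2a, which turns
  [1/2, 1) into (0, 1].\<close>

definition rhs_fun :: "nat \<Rightarrow> real \<Rightarrow> real" where
  "rhs_fun k t = t * (1 + (\<Sum>i=0..k. 1 / fact i * ln (1 / t) ^ i))"

lemma alpha_rhs_eq: "alpha_rhs k a = rhs_fun k (2 - 2 * a)"
  by (simp add: alpha_rhs_def rhs_fun_def)

text \<open>The right side has the additional summand 1 and the additional term i = k; both are
  nonnegative because ln(1/t) \<ge> 0.\<close>

lemma hyperbolic_vol_le_rhs_fun:
  assumes "0 < t" "t \<le> 1"
  shows "hyperbolic_vol k t \<le> rhs_fun k t"
proof -
  have "(\<Sum>i<k. ln (1 / t) ^ i / fact i) \<le> (\<Sum>i=0..k. 1 / fact i * ln (1 / t) ^ i)"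
    using assms by (simp, intro sum_mono2) (auto)
  then show ?thesis
    unfolding hyperbolic_vol_def rhs_fun_def using assms by (intro mult_left_mono) auto
qed

text \<open>The derivatives telescope: passing from k to k + 1 adds t ln(1/t)^(k+1) / (k+1)!, whose
  derivative is ln(1/t)^(k+1) / (k+1)! - ln(1/t)^k / k!.\<close>

lemma rhs_fun_has_derivative:
  assumes "0 < t"
  shows "(rhs_fun k has_real_derivative 1 + ln (1 / t) ^ k / fact k) (at t)"
proof (induction k)
  case 0
  have "rhs_fun 0 = (\<lambda>t. 2 * t)" by (auto simp: rhs_fun_def)
  then show ?case by (auto intro!: derivative_eq_intros)
next
  case (Suc k)
  have L: "((\<lambda>t. ln (1 / t)) has_real_derivative - (1 / t)) (at t)"
    using assms by (auto intro!: derivative_eq_intros simp: field_simps)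
  have eq: "rhs_fun (Suc k) = (\<lambda>t. rhs_fun k t + t * (ln (1 / t) ^ Suc k / fact (Suc k)))"
    by (auto simp: rhs_fun_def algebra_simps)
  have "((\<lambda>t. ln (1 / t) ^ Suc k / fact (Suc k)) has_real_derivative
      - (ln (1 / t) ^ k / fact k / t)) (at t)"
    by (rule DERIV_cong[OF DERIV_cdivide[OF DERIV_power[OF L, of "Suc k"], of "fact (Suc k)"]])
       (use assms in \<open>simp add: divide_simps del: of_nat_Suc\<close>)
  from DERIV_add[OF Suc DERIV_mult[OF DERIV_ident this]] show ?case
    unfolding eq by (rule DERIV_cong) (use assms in simp)
qed

lemma rhs_fun_strict_mono:
  assumes "0 < s" "s < t" "t \<le> 1"
  shows "rhs_fun k s < rhs_fun k t"
proof (rule DERIV_pos_imp_increasing[OF assms(2)])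
  fix x assume "s \<le> x" "x \<le> t"
  then have x: "0 < x" "x \<le> 1" using assms by auto
  then have "0 \<le> ln (1 / x) ^ k / fact k" by simp
  then show "\<exists>y. (rhs_fun k has_real_derivative y) (at x) \<and> 0 < y"
    using rhs_fun_has_derivative[OF x(1), of k] by (intro exI[of _ "1 + ln (1 / x) ^ k / fact k"]) simp
qed

text \<open>With u = ln(1/t) each term t ln(1/t)^i becomes u^i / exp u, where u tends to
  infinity.\<close>

lemma rhs_fun_tendsto_0: "(rhs_fun k \<longlongrightarrow> 0) (at_right 0)"
proof -
  have lim: "((\<lambda>t::real. t * ln (1 / t) ^ i) \<longlongrightarrow> 0) (at_right 0)" for i
  proof -
    have "((\<lambda>x::real. x ^ i / exp x) \<longlongrightarrow> 0) at_top" by (rule tendsto_power_div_exp_0)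
    moreover have "filterlim (\<lambda>t::real. ln (1 / t)) at_top (at_right 0)"
      using filterlim_compose[OF ln_at_top filterlim_inverse_at_top_right]
      by (simp add: inverse_eq_divide)
    ultimately have "((\<lambda>t::real. ln (1 / t) ^ i / exp (ln (1 / t))) \<longlongrightarrow> 0) (at_right 0)"
      by (rule filterlim_compose)
    moreover have "\<forall>\<^sub>F t::real in at_right 0. ln (1 / t) ^ i / exp (ln (1 / t)) = t * ln (1 / t) ^ i"
      by (rule eventually_at_rightI[of 0 1]) auto
    ultimately show ?thesis by (rule Lim_transform_eventually)
  qed
  have "rhs_fun k = (\<lambda>t. t + (\<Sum>i=0..k. 1 / fact i * (t * ln (1 / t) ^ i)))"
    by (auto simp: rhs_fun_def algebra_simps sum_distrib_left)
  moreover have "((\<lambda>t::real. t + (\<Sum>i=0..k. 1 / fact i * (t * ln (1 / t) ^ i)))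
      \<longlongrightarrow> 0 + (\<Sum>i=0..k. 1 / fact i * 0)) (at_right 0)"
    by (intro tendsto_add[OF tendsto_ident_at] tendsto_sum tendsto_mult[OF tendsto_const] lim)
  ultimately show ?thesis by simp
qed

lemma rhs_fun_fixpoint:
  obtains t where "0 < t" "t < 1" "rhs_fun k t = 1 - t / 2"
proof -
  have "\<forall>\<^sub>F t in at_right 0. rhs_fun k t < 1 / 2"
    by (rule order_tendstoD[OF rhs_fun_tendsto_0]) simp
  then obtain d where d: "0 < d" "\<And>t. 0 < t \<Longrightarrow> t < d \<Longrightarrow> rhs_fun k t < 1 / 2"
    by (auto simp: eventually_at_right_field)
  \<comment> \<open>Halving \<open>d\<close> keeps \<open>s\<close> strictly below it, and s \<le>
    1/2 gives \<open>rhs_fun k s + s / 2\<close> < 3/4 < 1. At t = 1 the same sum is 5/2, so the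
    value 1 is attained in between.\<close>
  define s where "s = min (d / 2) (1 / 2)"
  have s: "0 < s" "s \<le> 1 / 2" "rhs_fun k s < 1 / 2"
    using d by (auto simp: s_def min_def)
  have one: "rhs_fun k 1 = 2"
    by (simp add: rhs_fun_def power_0_left if_distrib cong: if_cong)
  have "\<exists>t. s \<le> t \<and> t \<le> 1 \<and> rhs_fun k t + t / 2 = 1"
  proof (rule IVT)
    show "\<forall>t. s \<le> t \<and> t \<le> 1 \<longrightarrow> isCont (\<lambda>t. rhs_fun k t + t / 2) t"
      using s by (auto intro!: continuous_intros DERIV_isCont[OF rhs_fun_has_derivative])
  qed (use s one in auto)
  then obtain t where t: "s \<le> t" "t \<le> 1" "rhs_fun k t + t / 2 = 1" by blast
  moreover from t one have "t \<noteq> 1" by auto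
  ultimately show ?thesis using s by (intro that[of t]) auto
qed

lemma is_alpha_root_unique:
  assumes "0 < t" "t < 1" "rhs_fun k t = 1 - t / 2"
  shows "is_alpha_root k a \<longleftrightarrow> a = 1 - t / 2"
proof
  assume "is_alpha_root k a"
  then have a: "1 / 2 \<le> a" "a \<le> 1" "a = rhs_fun k (2 - 2 * a)"
    by (auto simp: is_alpha_root_def alpha_rhs_eq)
  \<comment> \<open>At a = 1 the prefactor is 0, so the right-hand side is 0 rather than 1.\<close>
  have "a \<noteq> 1" using a(3) by (auto simp: rhs_fun_def)
  then have u: "0 < 2 - 2 * a" "2 - 2 * a \<le> 1" using a by auto
  show "a = 1 - t / 2"
    \<comment> \<open>A second root would put a larger value of the increasing
      \<open>rhs_fun k\<close> against a smaller value of the decreasing 1 - t/2, or the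
      reverse.\<close>
    using rhs_fun_strict_mono[of t "2 - 2 * a" k] rhs_fun_strict_mono[of "2 - 2 * a" t k] u assms a(3)
    by (cases t "2 - 2 * a" rule: linorder_cases) auto
next
  assume "a = 1 - t / 2"
  then show "is_alpha_root k a" using assms by (auto simp: is_alpha_root_def alpha_rhs_eq)
qed

section \<open>The bound on the supremum\<close>

lemma unit_cube_eq_cbox: "unit_cube = cbox 0 (One :: real ^ 'k::finite)"
proof -
  have "(One :: real ^ 'k) $ i = 1" for i
    by (simp add: cart_eq_inner_axis inner_sum_left_Basis axis_in_Basis_iff)
  then show ?thesis by (auto simp: unit_cube_def mem_box_cart)
qed

text \<open>Unique existence is part of the claim because \<open>alpha_star\<close> is a definite
  description, which says nothing without it.\<close>

theorem theorem5p3: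
  "(\<exists>!a. is_alpha_root CARD('k::finite) a) \<and> c_tilde TYPE('k) \<le> alpha_star CARD('k)"
proof -
  let ?k = "CARD('k)"
  obtain t where t: "0 < t" "t < 1" "rhs_fun ?k t = 1 - t / 2"
    by (rule rhs_fun_fixpoint)
  note root = is_alpha_root_unique[OF t]
  have star: "alpha_star ?k = 1 - t / 2"
    by (simp add: alpha_star_def root)
  have "measure lebesgue S \<le> 1 - t / 2"
    if S: "S \<subseteq> unit_cube" "S \<in> sets lebesgue" "sumfree S" for S :: "(real ^ 'k) set"
  \<comment> \<open>Vol(S) > 1 - t/2 says exactly that 2 (1 - Vol(S)) < t. The volume bound then
    applies at the fixed \<open>t\<close>, and \<open>rhs_fun\<close> takes the value 1 - t/2 there,
    a contradiction.\<close>
  proof (rule ccontr)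
    assume "\<not> ?thesis"
    then have gt: "measure lebesgue S > 1 - t / 2" by simp
    have "measure lebesgue S \<le> hyperbolic_vol DIM(real ^ 'k) t"
      using S t gt by (intro measure_sumfree_le) (auto simp: unit_cube_eq_cbox)
    also have "\<dots> \<le> 1 - t / 2"
      using hyperbolic_vol_le_rhs_fun[of t ?k] t by simp
    finally show False using gt by simp
  qed
  then have "c_tilde TYPE('k) \<le> 1 - t / 2"
    \<comment> \<open>The empty set witnesses that the supremum is over a nonempty set.\<close>
    unfolding c_tilde_def by (intro cSup_least) (auto simp: sumfree_def intro!: exI[of _ "{}"])
  with star root show ?thesis by auto
qed

end
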